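(* Let $G$ be a non-cyclic group having a maximal subgroup $M$ that is cyclic of order $p^n$ with $p$ prime and $n\geq 1$. Then $H_1(|\mathcal{C}(G)|;\mathbb{Z})$ has rank at least $(p-1)(G:M)$, and has infinite rank if $G$ is infinite. In particular $|\mathcal{C}(G)|$ is not simply connected.
   Context: For a group $G$, the coset poset $\mathcal{C}(G)$ is the set of left cosets of all proper subgroups of $G$ (including the trivial subgroup), ordered by inclusion, and $|\mathcal{C}(G)|$ is the geometric realization of its order complex (chains). *)

theory Defs
  imports "HOL-Analysis.Analysis" "HOL-Homology.Homology" "HOL-Algebra.Algebra"
begin

definition maximal_subgroup :: "'a set \<Rightarrow> ('a, 'b) monoid_scheme \<Rightarrow> bool" where
  "maximal_subgroup M G \<longleftrightarrow> subgroup M G \<and> M \<noteq> carrier G \<and>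
     (\<forall>H. subgroup H G \<and> M \<subseteq> H \<longrightarrow> H = M \<or> H = carrier G)"

text \<open>Coset poset: left cosets of all proper subgroups (including the trivial one),
  ordered by inclusion (the order is set inclusion on these sets).\<close>
definition coset_poset :: "('a, 'b) monoid_scheme \<Rightarrow> 'a set set" where
  "coset_poset G = {g <#\<^bsub>G\<^esub> H | g H. g \<in> carrier G \<and> subgroup H G \<and> H \<noteq> carrier G}"

definition subset_chain :: "'c set set \<Rightarrow> bool" where
  "subset_chain S \<longleftrightarrow> (\<forall>x\<in>S. \<forall>y\<in>S. x \<subseteq> y \<or> y \<subseteq> x)"

text \<open>Points of the geometric realization of the order complex of the poset (P, \<subseteq>):
  barycentric coordinate functions with finite support a nonempty chain of P.\<close>
definition realization_points :: "'c set set \<Rightarrow> ('c set \<Rightarrow> real) set" where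
  "realization_points P = {f. (\<forall>x. 0 \<le> f x) \<and> finite {x. f x \<noteq> 0} \<and> {x. f x \<noteq> 0} \<subseteq> P
        \<and> subset_chain {x. f x \<noteq> 0} \<and> sum f {x. f x \<noteq> 0} = 1}"

definition closed_simplex :: "'c set set \<Rightarrow> 'c set set \<Rightarrow> ('c set \<Rightarrow> real) set" where
  "closed_simplex P \<sigma> = {f \<in> realization_points P. {x. f x \<noteq> 0} \<subseteq> \<sigma>}"

text \<open>Geometric realization with the weak (coherent) topology: a set is open iff its
  intersection with every closed simplex is open in the (Euclidean) topology of that simplex.\<close>
definition order_complex_realization :: "'c set set \<Rightarrow> ('c set \<Rightarrow> real) topology" where
  "order_complex_realization P = topology (\<lambda>U. U \<subseteq> realization_points P \<and>
     (\<forall>\<sigma>. finite \<sigma> \<and> \<sigma> \<subseteq> P \<and> subset_chain \<sigma> \<longrightarrow>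
        openin (subtopology (powertop_real UNIV) (closed_simplex P \<sigma>)) (U \<inter> closed_simplex P \<sigma>)))"

definition int_independent :: "('a, 'b) monoid_scheme \<Rightarrow> 'a set \<Rightarrow> bool" where
  "int_independent A S \<longleftrightarrow> S \<subseteq> carrier A \<and> finite S \<and>
     (\<forall>c :: 'a \<Rightarrow> int. finprod A (\<lambda>x. x [^]\<^bsub>A\<^esub> (c x)) S = one A \<longrightarrow> (\<forall>x\<in>S. c x = 0))"

definition rank_at_least :: "('a, 'b) monoid_scheme \<Rightarrow> nat \<Rightarrow> bool" where
  "rank_at_least A k \<longleftrightarrow> (\<exists>S. int_independent A S \<and> card S = k)"

definition infinite_rank :: "('a, 'b) monoid_scheme \<Rightarrow> bool" where
  "infinite_rank A \<longleftrightarrow> (\<forall>k. rank_at_least A k)"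

definition simply_connected_space :: "'a topology \<Rightarrow> bool" where
  "simply_connected_space T \<longleftrightarrow> path_connected_space T \<and>
     (\<forall>p. pathin T p \<and> p (1::real) = p 0 \<longrightarrow>
        homotopic_with (\<lambda>q. q 0 = p 0 \<and> q 1 = p 0) (top_of_set {0..1}) T p (\<lambda>t. p 0))"

end

theory Submission
  imports Defs "HOL-Algebra.Left_Coset"
begin

text \<open>
  Each left coset \<open>C\<close> of \<open>M\<close> is a maximal element of the coset poset, and since the proper subgroups
  of a cyclic \<open>p\<close>-group lie in its unique maximal subgroup, the elements below \<open>C\<close> fall into \<open>p\<close>
  components, one for each residue of the exponent modulo \<open>p\<close>. Every pair of a coset \<open>C\<close> and a nonzero
  residue \<open>i\<close> yields a map of the realization to the circle that winds once along an edge path passing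
  through \<open>C\<close> into the component \<open>i\<close>, and is constant elsewhere. In the opposite direction there is a closed
  hexagonal edge path that passes through \<open>C\<close> from component \<open>0\<close> to component \<open>i\<close> and returns avoiding all
  cosets of \<open>M\<close>; the return exists because \<open>G\<close> is not cyclic and is generated by the complement
  of \<open>M\<close>. The matrix of the degrees is the identity, so the classes of the hexagons are independent
  in the first homology group.
\<close>

section \<open>The circle as a quotient of the interval\<close>

text \<open>Scaled to period 1, so that integer jumps of a real-valued function vanish after
  composition. Points of \<open>nsphere 1\<close> are functions on all of \<open>nat\<close>, hence
  the zeros beyond index 1.\<close>

definition circ :: "real \<Rightarrow> nat \<Rightarrow> real" where
  "circ t = (\<lambda>i. if i = 0 then cos (2 * pi * t) else if i = 1 then sin (2 * pi * t) else 0)"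

text \<open>An arbitrary section of \<open>circ\<close> over the circle, discontinuous and ambiguous
  between 0 and 1 at the base point. Following it by a loop cures both defects.\<close>

definition circ_arg :: "(nat \<Rightarrow> real) \<Rightarrow> real" where
  "circ_arg z = (SOME t. t \<in> {0..1} \<and> circ t = z)"

lemma continuous_map_circ: "continuous_map euclideanreal (nsphere 1) circ"
proof -
  have "continuous_map euclideanreal euclideanreal (\<lambda>t. circ t i)" for i
    by (cases "i = 1") (auto simp: circ_def intro!: continuous_intros)
  moreover have "range circ \<subseteq> {x. (\<Sum>i\<le>1. (x i)\<^sup>2) = 1 \<and> (\<forall>i>1. x i = 0)}"
    by (auto simp: circ_def)
  ultimately show ?thesis
    by (auto simp: nsphere continuous_map_in_subtopology continuous_map_componentwise_UNIV)
qed

lemma circ_in_nsphere [simp]: "circ t \<in> topspace (nsphere 1)"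
  using continuous_map_circ by (auto simp: continuous_map_def)

lemma circ_eq_iff: "circ s = circ t \<longleftrightarrow> (\<exists>n::int. s = t + n)"
proof -
  have "circ s = circ t \<longleftrightarrow> sin (2 * pi * s) = sin (2 * pi * t) \<and> cos (2 * pi * s) = cos (2 * pi * t)"
    by (auto simp: circ_def fun_eq_iff split: if_splits)
  also have "\<dots> \<longleftrightarrow> (\<exists>n::int. 2 * pi * s = 2 * pi * t + 2 * pi * n)"
    using sin_cos_eq_iff by blast
  also have "\<dots> \<longleftrightarrow> (\<exists>n::int. s = t + n)"
    by (simp flip: distrib_left)
  finally show ?thesis .
qed

lemma circ_eq_unit_interval:
  assumes "s \<in> {0..1}" "t \<in> {0..1}" "circ s = circ t"
  shows "s = t \<or> s = 0 \<and> t = 1 \<or> s = 1 \<and> t = 0"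
proof -
  obtain n :: int where n: "s = t + n"
    using assms circ_eq_iff by blast
  then have "n = -1 \<or> n = 0 \<or> n = 1"
    using assms by auto
  then show ?thesis
    using n assms by auto
qed

lemma circ_surj:
  assumes "z \<in> topspace (nsphere 1)"
  obtains t where "t \<in> {0..1}" "circ t = z"
proof -
  have z: "(z 0)\<^sup>2 + (z 1)\<^sup>2 = 1" "\<And>i. i > 1 \<Longrightarrow> z i = 0"
    using assms by (auto simp: nsphere)
  obtain s where s: "0 \<le> s" "s < 2 * pi" "z 0 = cos s" "z 1 = sin s"
    using sincos_total_2pi [OF z(1)] by metis
  show thesis
  proof
    show "s / (2 * pi) \<in> {0..1}"
      using s by (auto simp: field_simps)
    show "circ (s / (2 * pi)) = z"
      using s z(2) by (auto simp: circ_def fun_eq_iff)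
  qed
qed

lemma
  assumes "z \<in> topspace (nsphere 1)"
  shows circ_arg_in: "circ_arg z \<in> {0..1}" and circ_circ_arg: "circ (circ_arg z) = z"
proof -
  have "circ_arg z \<in> {0..1} \<and> circ (circ_arg z) = z"
    unfolding circ_arg_def by (rule someI_ex) (use circ_surj [OF assms] in blast)
  then show "circ_arg z \<in> {0..1}" "circ (circ_arg z) = z"
    by auto
qed

text \<open>Whichever endpoint \<open>circ_arg\<close> picks at the base point, \<open>f\<close>
  takes the same value at both.\<close>

lemma loop_circ_arg:
  assumes "f 0 = f 1" "t \<in> {0..1}"
  shows "f (circ_arg (circ t)) = f t"
proof -
  have "circ_arg (circ t) = t \<or> circ_arg (circ t) = 0 \<and> t = 1 \<or> circ_arg (circ t) = 1 \<and> t = 0"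
    using assms(2) by (intro circ_eq_unit_interval circ_arg_in circ_circ_arg circ_in_nsphere)
  then show ?thesis
    using assms(1) by (elim disjE conjE) simp_all
qed

lemma Hausdorff_space_nsphere: "Hausdorff_space (nsphere n)"
  unfolding nsphere by (simp add: Hausdorff_space_subtopology Hausdorff_space_product_topology)

lemma continuous_map_circ_interval: "continuous_map (top_of_set {0..1}) (nsphere 1) circ"
  using continuous_map_circ continuous_map_from_subtopology by blast

lemma image_circ: "circ ` {0..1} = topspace (nsphere 1)"
proof
  show "circ ` {0..1} \<subseteq> topspace (nsphere 1)"
    using circ_in_nsphere by blast
  show "topspace (nsphere 1) \<subseteq> circ ` {0..1}"
    by (metis circ_surj image_eqI subsetI)
qed

text \<open>A continuous map from a compact space to a Hausdorff space is closed, and a closed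
  continuous surjection is a quotient map.\<close>

lemma quotient_map_circ: "quotient_map (top_of_set {0..1}) (nsphere 1) circ"
proof (intro continuous_closed_imp_quotient_map continuous_map_circ_interval)
  have "compact_space (top_of_set {0..1::real})"
    by (simp add: compact_space_subtopology)
  then show "closed_map (top_of_set {0..1}) (nsphere 1) circ"
    by (rule continuous_imp_closed_map [OF continuous_map_circ_interval _ Hausdorff_space_nsphere])
qed (use image_circ in simp)

text \<open>Products of quotient maps need not be quotient maps, so compactness of the square is
  used directly.\<close>

lemma quotient_map_circ_cylinder:
  "quotient_map (prod_topology (top_of_set {0..1}) (top_of_set {0..1}))
     (prod_topology (top_of_set {0..1::real}) (nsphere 1)) (\<lambda>(s, t). (s, circ t))"
proof -
  let ?I = "top_of_set {0..1::real}" and ?q = "\<lambda>(s, t). (s :: real, circ t)"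
  have cont: "continuous_map (prod_topology ?I ?I) (prod_topology ?I (nsphere 1)) ?q"
    unfolding case_prod_unfold
    by (rule continuous_map_pairedI [OF continuous_map_fst
          continuous_map_compose [OF continuous_map_snd continuous_map_circ_interval, unfolded comp_def]])
  have "closed_map (prod_topology ?I ?I) (prod_topology ?I (nsphere 1)) ?q"
  proof (rule continuous_imp_closed_map [OF cont])
    show "compact_space (prod_topology ?I ?I)"
      by (simp add: compact_space_subtopology compact_Times)
    show "Hausdorff_space (prod_topology ?I (nsphere 1))"
      by (simp add: Hausdorff_space_prod_topology Hausdorff_space_nsphere Hausdorff_space_subtopology)
  qed
  moreover have "?q ` ({0..1} \<times> {0..1}) = {0..1} \<times> circ ` {0..1}"
    by auto
  ultimately show ?thesis
    using cont by (intro continuous_closed_imp_quotient_map) (simp_all add: image_circ)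
qed

text \<open>Continuity is tested after pulling back along the quotient map, where the composite is
  \<open>f\<close> itself on the unit interval.\<close>

lemma continuous_map_loop_circle:
  assumes "pathin T f" "f 0 = f 1"
  shows "continuous_map (nsphere 1) T (f \<circ> circ_arg)"
proof (rule continuous_compose_quotient_map [OF quotient_map_circ])
  show "continuous_map (top_of_set {0..1}) T ((f \<circ> circ_arg) \<circ> circ)"
    using assms(1) unfolding pathin_def
    by (rule continuous_map_eq) (use assms(2) in \<open>auto simp: loop_circ_arg\<close>)
qed

text \<open>The invariant \<open>q 0 = q 1\<close> makes every stage a loop, so the homotopy
  descends through the quotient from the square to the cylinder. The base point may move.\<close>

lemma homotopic_loops_imp_circle:
  assumes "homotopic_with (\<lambda>q. q 0 = q 1) (top_of_set {0..1}) T f g"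
  shows "homotopic_with (\<lambda>q. True) (nsphere 1) T (f \<circ> circ_arg) (g \<circ> circ_arg)"
proof -
  obtain h where h: "continuous_map (prod_topology (top_of_set {0..1::real}) (top_of_set {0..1})) T h"
    and h0: "\<And>x. h (0, x) = f x" and h1: "\<And>x. h (1, x) = g x"
    and hl: "\<And>s. s \<in> {0..1} \<Longrightarrow> h (s, 0) = h (s, 1)"
    using assms unfolding homotopic_with_def by metis
  let ?k = "\<lambda>(s, z). h (s, circ_arg z)"
  have "continuous_map (prod_topology (top_of_set {0..1}) (nsphere 1)) T ?k"
  proof (rule continuous_compose_quotient_map [OF quotient_map_circ_cylinder])
    have "h (s, circ_arg (circ t)) = h (s, t)" if "s \<in> {0..1}" "t \<in> {0..1}" for s t
      using loop_circ_arg [where f = "\<lambda>t. h (s, t)"] hl that by blast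
    then show "continuous_map (prod_topology (top_of_set {0..1}) (top_of_set {0..1})) T
        (?k \<circ> (\<lambda>(s, t). (s, circ t)))"
      using h by (intro continuous_map_eq [OF h]) auto
  qed
  then show ?thesis
    unfolding homotopic_with_def by (intro exI [of _ ?k]) (auto simp: h0 h1)
qed

section \<open>A rank criterion\<close>

text \<open>Degree is a homotopy invariant, and \<open>circ\<close> after \<open>circ_arg\<close> is
  the identity of the circle.\<close>

lemma Brouwer_degree2_circ_loop:
  assumes "homotopic_with (\<lambda>q. q 0 = q 1) (top_of_set {0..1}) (nsphere 1) f circ"
  shows "Brouwer_degree2 1 (f \<circ> circ_arg) = 1"
proof -
  have "homotopic_with (\<lambda>q. True) (nsphere 1) (nsphere 1) (f \<circ> circ_arg) (circ \<circ> circ_arg)"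
    using assms by (rule homotopic_loops_imp_circle)
  then have "Brouwer_degree2 1 (f \<circ> circ_arg) = Brouwer_degree2 1 (circ \<circ> circ_arg)"
    by (rule Brouwer_degree2_homotopic)
  also have "\<dots> = Brouwer_degree2 1 id"
    by (rule Brouwer_degree2_eq) (simp add: circ_circ_arg)
  finally show ?thesis
    by simp
qed

lemma finprod_group_hom:
  assumes "comm_group A" "comm_group B" "h \<in> hom A B" "finite S" "f \<in> S \<rightarrow> carrier A"
  shows "h (finprod A f S) = finprod B (h \<circ> f) S"
proof -
  interpret A: comm_group A by fact
  interpret B: comm_group B by fact
  interpret h: group_hom A B h
    using assms(3) by (simp add: group_hom_def group_hom_axioms_def)
  show ?thesis
    using assms(4,5) by (induction S rule: finite_induct) (auto simp: Pi_iff)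
qed

text \<open>Applying \<open>h i\<close> to a relation kills every term except the
  \<open>i\<close>-th and leaves a power of \<open>z\<close>, whose order is infinite.\<close>

lemma rank_at_least_dual_family:
  fixes A :: "('a, 'm) monoid_scheme" and B :: "('b, 'n) monoid_scheme" and x :: "'i \<Rightarrow> 'a"
  assumes A: "comm_group A" and B: "comm_group B" and I: "finite I"
    and x: "\<And>i. i \<in> I \<Longrightarrow> x i \<in> carrier A"
    and h: "\<And>i. i \<in> I \<Longrightarrow> h i \<in> hom A B"
    and z: "z \<in> carrier B" "\<And>k::int. z [^]\<^bsub>B\<^esub> k = \<one>\<^bsub>B\<^esub> \<Longrightarrow> k = 0"
    and dual: "\<And>i j. i \<in> I \<Longrightarrow> j \<in> I \<Longrightarrow> h i (x j) = (if i = j then z else \<one>\<^bsub>B\<^esub>)"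
  shows "rank_at_least A (card I)"
proof -
  interpret A: comm_group A by fact
  interpret B: comm_group B by fact
  have hom: "group_hom A B (h i)" if "i \<in> I" for i
    using h that by (simp add: group_hom_def group_hom_axioms_def)
  have z1: "z \<noteq> \<one>\<^bsub>B\<^esub>"
    using z(2) [of 1] by (auto simp: B.int_pow_1)
  \<comment> \<open>Independence is a property of a set, so the elements must be distinct for its
    cardinality to be that of \<open>I\<close>.\<close>
  have inj: "inj_on x I"
  proof (rule inj_onI)
    fix i j
    assume "i \<in> I" "j \<in> I" "x i = x j"
    then show "i = j"
      using dual [of i i] dual [of i j] z1 by (simp split: if_splits)
  qed
  have "int_independent A (x ` I)"
    unfolding int_independent_def
  proof (intro conjI allI impI ballI)
    fix c :: "'a \<Rightarrow> int" and y
    assume c: "finprod A (\<lambda>x. x [^]\<^bsub>A\<^esub> c x) (x ` I) = \<one>\<^bsub>A\<^esub>" and "y \<in> x ` I"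
    then obtain i where i: "i \<in> I" "y = x i"
      by auto
    interpret h: group_hom A B "h i"
      by (rule hom) fact
    have "\<one>\<^bsub>B\<^esub> = h i (finprod A (\<lambda>j. x j [^]\<^bsub>A\<^esub> c (x j)) I)"
      using c x inj by (subst (asm) A.finprod_reindex) auto
    also have "\<dots> = finprod B (h i \<circ> (\<lambda>j. x j [^]\<^bsub>A\<^esub> c (x j))) I"
      using x by (intro finprod_group_hom A B h i I) auto
    also have "\<dots> = finprod B (\<lambda>j. if i = j then z [^]\<^bsub>B\<^esub> c (x j) else \<one>\<^bsub>B\<^esub>) I"
      using x i z(1) by (intro B.finprod_cong') (auto simp: h.hom_int_pow dual)
    also have "\<dots> = z [^]\<^bsub>B\<^esub> c (x i)"
      using i I z(1) by (intro B.finprod_singleton) auto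
    finally show "c y = 0"
      using z(2) [of "c (x i)"] i by simp
  qed (use x I in auto)
  then show ?thesis
    unfolding rank_at_least_def using card_image [OF inj] by blast
qed

text \<open>Push a generator of the first homology of the circle forward along each loop. Pairing
  with the maps gives the matrix of degrees: one on the diagonal by the homotopy to
  \<open>circ\<close>, zero elsewhere because the composite is constant.\<close>

lemma rank_at_least_homology_circle_maps:
  assumes I: "finite I"
    and loops: "\<And>i. i \<in> I \<Longrightarrow> pathin T (\<gamma> i)" "\<And>i. i \<in> I \<Longrightarrow> \<gamma> i 0 = \<gamma> i 1"
    and maps: "\<And>i. i \<in> I \<Longrightarrow> continuous_map T (nsphere 1) (\<phi> i)"
    and diag: "\<And>i. i \<in> I \<Longrightarrow>
      homotopic_with (\<lambda>q. q 0 = q 1) (top_of_set {0..1}) (nsphere 1) (\<phi> i \<circ> \<gamma> i) circ"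
    and off: "\<And>i j t. \<lbrakk>i \<in> I; j \<in> I; i \<noteq> j; t \<in> {0..1}\<rbrakk> \<Longrightarrow> \<phi> i (\<gamma> j t) = a"
  shows "rank_at_least (homology_group 1 T) (card I)"
proof -
  let ?S = "homology_group 1 (nsphere 1)"
  have red: "reduced_homology_group 1 (nsphere 1) = ?S"
    by (simp add: un_reduced_homology_group)
  interpret S: comm_group ?S
    by (rule abelian_homology_group)
  obtain z where z: "z \<in> carrier ?S" and gen: "subgroup_generated ?S {z} = ?S"
    using cyclic_reduced_homology_group_nsphere [of 1 1] unfolding cyclic_group_def by (metis One_nat_def red of_nat_1)
  \<comment> \<open>The group is isomorphic to the integers, so its generator has infinite order,
    which is encoded as \<open>ord z = 0\<close>.\<close>
  have "infinite (carrier ?S)"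
    using iso_finite [OF reduced_homology_group_nsphere(1) [of 1]] red by (simp del: One_nat_def)
  then have "S.ord z = 0"
    using S.infinite_cyclic_subgroup_order [OF z] gen by simp
  then have z0: "k = 0" if "z [^]\<^bsub>?S\<^esub> k = \<one>\<^bsub>?S\<^esub>" for k :: int
    using that z by (simp add: S.int_pow_eq_id del: One_nat_def)
  \<comment> \<open>Functoriality turns the composite into a self-map of the circle, which acts on
    the generator through its degree.\<close>
  have deg: "hom_induced 1 T {} (nsphere 1) {} (\<phi> i)
       (hom_induced 1 (nsphere 1) {} T {} (\<gamma> j \<circ> circ_arg) z)
     = z [^]\<^bsub>?S\<^esub> Brouwer_degree2 1 (\<phi> i \<circ> \<gamma> j \<circ> circ_arg)" if "i \<in> I" "j \<in> I" for i j
    using that Brouwer_degree2 [of z 1 "\<phi> i \<circ> (\<gamma> j \<circ> circ_arg)"] z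
    by (simp add: red comp_assoc loops maps continuous_map_loop_circle hom_induced_compose' del: One_nat_def)
  have deg': "Brouwer_degree2 1 (\<phi> i \<circ> \<gamma> j \<circ> circ_arg) = (if i = j then 1 else 0)"
    if ij: "i \<in> I" "j \<in> I" for i j
  proof (cases "i = j")
    case True
    then show ?thesis
      using Brouwer_degree2_circ_loop [OF diag] ij by simp
  next
    case False
    then have "Brouwer_degree2 1 (\<phi> i \<circ> \<gamma> j \<circ> circ_arg) = Brouwer_degree2 1 (\<lambda>x. a)"
      by (intro Brouwer_degree2_eq) (use ij circ_arg_in in \<open>auto intro!: off\<close>)
    then show ?thesis
      using False by (simp add: Brouwer_degree2_const)
  qed
  show ?thesis
  proof (rule rank_at_least_dual_family [where z = z and B = ?S and h = "\<lambda>i. hom_induced 1 T {} (nsphere 1) {} (\<phi> i)"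
        and x = "\<lambda>i. hom_induced 1 (nsphere 1) {} T {} (\<gamma> i \<circ> circ_arg) z"])
    show "hom_induced 1 (nsphere 1) {} T {} (\<gamma> i \<circ> circ_arg) z \<in> carrier (homology_group 1 T)"
      for i by (rule hom_induced_carrier)
    show "hom_induced 1 T {} (nsphere 1) {} (\<phi> i) \<in> hom (homology_group 1 T) ?S" for i
      by (rule hom_induced_empty_hom)
    show "hom_induced 1 T {} (nsphere 1) {} (\<phi> i) (hom_induced 1 (nsphere 1) {} T {} (\<gamma> j \<circ> circ_arg) z)
        = (if i = j then z else \<one>\<^bsub>?S\<^esub>)" if "i \<in> I" "j \<in> I" for i j
      using deg [OF that] deg' [OF that] z by (simp add: S.int_pow_1 del: One_nat_def)
  qed (use I z z0 abelian_homology_group in auto)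
qed

text \<open>A contraction of the loop would push forward to a null-homotopy on the circle, giving
  degree 0 where the degree is 1.\<close>

lemma not_simply_connected_circle_map:
  assumes \<gamma>: "pathin T \<gamma>" "\<gamma> 0 = \<gamma> 1" and \<phi>: "continuous_map T (nsphere 1) \<phi>"
    and hom: "homotopic_with (\<lambda>q. q 0 = q 1) (top_of_set {0..1}) (nsphere 1) (\<phi> \<circ> \<gamma>) circ"
  shows "\<not> simply_connected_space T"
proof
  assume "simply_connected_space T"
  then have "homotopic_with (\<lambda>q. q 0 = \<gamma> 0 \<and> q 1 = \<gamma> 0) (top_of_set {0..1}) T \<gamma> (\<lambda>t. \<gamma> 0)"
    unfolding simply_connected_space_def using \<gamma> by (elim conjE allE [of _ \<gamma>]) simp
  then have "homotopic_with (\<lambda>q. q 0 = q 1) (top_of_set {0..1}) (nsphere 1) (\<phi> \<circ> \<gamma>) (\<phi> \<circ> (\<lambda>t. \<gamma> 0))"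
    by (rule homotopic_with_compose_continuous_map_left [OF _ \<phi>]) simp
  from homotopic_loops_imp_circle [OF this]
  have "homotopic_with (\<lambda>q. True) (nsphere 1) (nsphere 1) (\<phi> \<circ> \<gamma> \<circ> circ_arg) (\<lambda>z. \<phi> (\<gamma> 0))"
    by (simp add: comp_def)
  then have "Brouwer_degree2 1 (\<phi> \<circ> \<gamma> \<circ> circ_arg) = 0"
    by (rule Brouwer_degree2_nullhomotopic)
  then show False
    using Brouwer_degree2_circ_loop [OF hom] by simp
qed

section \<open>Order complexes\<close>

text \<open>\<open>topology\<close> is meaningful only for predicates closed under binary
  intersections and arbitrary unions; verifying this makes the definition usable.\<close>

lemma openin_order_complex_realization:
  "openin (order_complex_realization P) U \<longleftrightarrow> U \<subseteq> realization_points P \<and>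
     (\<forall>\<sigma>. finite \<sigma> \<and> \<sigma> \<subseteq> P \<and> subset_chain \<sigma> \<longrightarrow>
        openin (subtopology (powertop_real UNIV) (closed_simplex P \<sigma>)) (U \<inter> closed_simplex P \<sigma>))"
proof -
  let ?L = "\<lambda>U. U \<subseteq> realization_points P \<and>
     (\<forall>\<sigma>. finite \<sigma> \<and> \<sigma> \<subseteq> P \<and> subset_chain \<sigma> \<longrightarrow>
        openin (subtopology (powertop_real UNIV) (closed_simplex P \<sigma>)) (U \<inter> closed_simplex P \<sigma>))"
  have "istopology ?L"
    unfolding istopology_def
  proof (intro conjI allI impI)
    fix S T \<sigma>
    assume S: "?L S" and T: "?L T" and \<sigma>: "finite \<sigma> \<and> \<sigma> \<subseteq> P \<and> subset_chain \<sigma>"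
    have "S \<inter> T \<inter> closed_simplex P \<sigma> = (S \<inter> closed_simplex P \<sigma>) \<inter> (T \<inter> closed_simplex P \<sigma>)"
      by blast
    then show "openin (subtopology (powertop_real UNIV) (closed_simplex P \<sigma>)) (S \<inter> T \<inter> closed_simplex P \<sigma>)"
      using S T \<sigma> by (simp add: openin_Int)
  next
    fix \<K> \<sigma>
    assume K: "\<forall>S\<in>\<K>. ?L S" and \<sigma>: "finite \<sigma> \<and> \<sigma> \<subseteq> P \<and> subset_chain \<sigma>"
    have "openin (subtopology (powertop_real UNIV) (closed_simplex P \<sigma>)) (\<Union>S\<in>\<K>. S \<inter> closed_simplex P \<sigma>)"
      using K \<sigma> by (intro openin_Union) blast
    then show "openin (subtopology (powertop_real UNIV) (closed_simplex P \<sigma>)) (\<Union>\<K> \<inter> closed_simplex P \<sigma>)"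
      by (simp only: Int_Union2)
  qed blast+
  then show ?thesis
    unfolding order_complex_realization_def by (simp add: topology_inverse')
qed

lemma topspace_order_complex_realization [simp]:
  "topspace (order_complex_realization P) = realization_points P"
proof (rule antisym)
  show "topspace (order_complex_realization P) \<subseteq> realization_points P"
    using openin_order_complex_realization [of P "topspace (order_complex_realization P)"] by simp
  have "realization_points P \<inter> closed_simplex P \<sigma>
      = topspace (subtopology (powertop_real UNIV) (closed_simplex P \<sigma>))" for \<sigma>
    by (auto simp: closed_simplex_def)
  then have "openin (order_complex_realization P) (realization_points P)"
    unfolding openin_order_complex_realization by (simp only: openin_topspace subset_refl simp_thms)
  then show "realization_points P \<subseteq> topspace (order_complex_realization P)"
    by (rule openin_subset)
qed

lemma continuous_map_closed_simplex_inclusion: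
  assumes "finite \<sigma>" "\<sigma> \<subseteq> P" "subset_chain \<sigma>"
  shows "continuous_map (subtopology (powertop_real UNIV) (closed_simplex P \<sigma>))
           (order_complex_realization P) id"
  unfolding continuous_map_def
proof (intro conjI allI impI)
  fix U
  assume "openin (order_complex_realization P) U"
  then have "openin (subtopology (powertop_real UNIV) (closed_simplex P \<sigma>)) (U \<inter> closed_simplex P \<sigma>)"
    using assms by (simp add: openin_order_complex_realization)
  moreover have "{x \<in> topspace (subtopology (powertop_real UNIV) (closed_simplex P \<sigma>)). id x \<in> U}
      = U \<inter> closed_simplex P \<sigma>"
    by auto
  ultimately show "openin (subtopology (powertop_real UNIV) (closed_simplex P \<sigma>))
      {x \<in> topspace (subtopology (powertop_real UNIV) (closed_simplex P \<sigma>)). id x \<in> U}"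
    by simp
qed (auto simp: closed_simplex_def)

text \<open>The topology is coherent with the closed simplices, so preimages of open sets are tested
  simplex by simplex. Values land in \<open>Y\<close> because each point lies in the simplex of its
  own support.\<close>

lemma continuous_map_from_order_complex_realization:
  assumes "\<And>\<sigma>. \<lbrakk>finite \<sigma>; \<sigma> \<subseteq> P; subset_chain \<sigma>\<rbrakk> \<Longrightarrow>
    continuous_map (subtopology (powertop_real UNIV) (closed_simplex P \<sigma>)) Y \<phi>"
  shows "continuous_map (order_complex_realization P) Y \<phi>"
  unfolding continuous_map_def
proof (intro conjI allI impI)
  show "\<phi> \<in> topspace (order_complex_realization P) \<rightarrow> topspace Y"
  proof
    fix f
    assume f: "f \<in> topspace (order_complex_realization P)"
    let ?\<sigma> = "{x. f x \<noteq> 0}"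
    have "continuous_map (subtopology (powertop_real UNIV) (closed_simplex P ?\<sigma>)) Y \<phi>"
      using f by (intro assms) (auto simp: realization_points_def)
    moreover have "f \<in> closed_simplex P ?\<sigma>"
      using f by (auto simp: closed_simplex_def)
    ultimately show "\<phi> f \<in> topspace Y"
      by (auto simp: continuous_map_def Pi_iff)
  qed
next
  fix U
  assume U: "openin Y U"
  have "openin (subtopology (powertop_real UNIV) (closed_simplex P \<sigma>))
      ({f \<in> realization_points P. \<phi> f \<in> U} \<inter> closed_simplex P \<sigma>)"
    if \<sigma>: "finite \<sigma>" "\<sigma> \<subseteq> P" "subset_chain \<sigma>" for \<sigma>
  proof -
    have "{f \<in> realization_points P. \<phi> f \<in> U} \<inter> closed_simplex P \<sigma>
        = {f \<in> topspace (subtopology (powertop_real UNIV) (closed_simplex P \<sigma>)). \<phi> f \<in> U}"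
      by (auto simp: closed_simplex_def)
    then show ?thesis
      using openin_continuous_map_preimage [OF assms [OF \<sigma>] U] by simp
  qed
  then show "openin (order_complex_realization P) {f \<in> topspace (order_complex_realization P). \<phi> f \<in> U}"
    by (auto simp: openin_order_complex_realization)
qed

subsection \<open>Edge paths\<close>

text \<open>Tent functions as barycentric coordinates put vertex \<open>v k\<close> at time
  \<open>k / n\<close>. Summing over indices rather than vertices keeps the total weight 1 when a
  vertex recurs, as in a closed path.\<close>

definition edge_path :: "nat \<Rightarrow> (nat \<Rightarrow> 'c set) \<Rightarrow> real \<Rightarrow> 'c set \<Rightarrow> real" where
  "edge_path n v t = (\<lambda>x. \<Sum>k\<le>n. if v k = x then max 0 (1 - \<bar>real n * t - real k\<bar>) else 0)"

text \<open>On this time interval all other tents vanish. The two terms are kept apart so that they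
  add up if both ends of the edge coincide.\<close>

lemma edge_path_on_edge:
  assumes "k < n" "real k \<le> real n * t" "real n * t \<le> real (Suc k)"
  shows "edge_path n v t x = (if v k = x then real (Suc k) - real n * t else 0) + (if v (Suc k) = x then real n * t - real k else 0)"
proof -
  have "edge_path n v t x = (\<Sum>j\<in>{k, Suc k}. if v j = x then max 0 (1 - \<bar>real n * t - real j\<bar>) else 0)"
    unfolding edge_path_def
  proof (rule sum.mono_neutral_right)
    show "\<forall>j\<in>{..n} - {k, Suc k}. (if v j = x then max 0 (1 - \<bar>real n * t - real j\<bar>) else 0) = 0"
    proof
      fix j
      assume "j \<in> {..n} - {k, Suc k}"
      then have "j < k \<or> j > Suc k"
        by auto
      then have "real j \<le> real k - 1 \<or> real j \<ge> real k + 2"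
        by auto
      then have "max 0 (1 - \<bar>real n * t - real j\<bar>) = 0"
        using assms by auto
      then show "(if v j = x then max 0 (1 - \<bar>real n * t - real j\<bar>) else 0) = 0"
        by simp
    qed
  qed (use assms in auto)
  then show ?thesis
    using assms by auto
qed

lemma edge_path_0: "edge_path n v 0 = (\<lambda>x. if v 0 = x then 1 else 0)"
proof
  fix x
  have "edge_path n v 0 x = (\<Sum>k\<in>{0}. if v k = x then max 0 (1 - real k) else 0)"
    unfolding edge_path_def by (rule sum.mono_neutral_cong_right) auto
  then show "edge_path n v 0 x = (if v 0 = x then 1 else 0)"
    by simp
qed

lemma edge_path_1: "edge_path n v 1 = (\<lambda>x. if v n = x then 1 else 0)"
proof
  fix x
  have "edge_path n v 1 x = (\<Sum>k\<in>{n}. if v k = x then max 0 (1 - \<bar>real n - real k\<bar>) else 0)"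
    unfolding edge_path_def by (rule sum.mono_neutral_cong_right) auto
  then show "edge_path n v 1 x = (if v n = x then 1 else 0)"
    by simp
qed

lemma segment_in_closed_simplex:
  assumes uw: "u \<in> P" "w \<in> P" "u \<subseteq> w \<or> w \<subseteq> u" and ab: "0 \<le> a" "0 \<le> b" "a + b = (1::real)"
  shows "(\<lambda>x. (if u = x then a else 0) + (if w = x then b else 0)) \<in> closed_simplex P {u, w}"
proof -
  let ?g = "\<lambda>x. (if u = x then a else 0) + (if w = x then b else 0)"
  have sub: "{x. ?g x \<noteq> 0} \<subseteq> {u, w}"
    by auto
  have "sum ?g {x. ?g x \<noteq> 0} = sum ?g {u, w}"
    by (rule sum.mono_neutral_left) auto
  also have "\<dots> = 1"
    using ab by (cases "u = w") auto
  finally have "sum ?g {x. ?g x \<noteq> 0} = 1" .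
  moreover have "subset_chain {x. ?g x \<noteq> 0}"
    using sub uw(3) unfolding subset_chain_def by blast
  moreover have "finite {x. ?g x \<noteq> 0}" "{x. ?g x \<noteq> 0} \<subseteq> P"
    using sub uw by (blast intro: finite_subset)+
  ultimately show ?thesis
    using sub ab by (auto simp: closed_simplex_def realization_points_def)
qed

text \<open>Paste over the \<open>n\<close> closed time intervals. On each the path stays in one
  closed simplex, where continuity is coordinatewise and from which the inclusion into the
  realization is continuous.\<close>

lemma pathin_edge_path:
  assumes n: "n > 0" and vP: "\<And>k. k \<le> n \<Longrightarrow> v k \<in> P"
    and adj: "\<And>k. k < n \<Longrightarrow> v k \<subseteq> v (Suc k) \<or> v (Suc k) \<subseteq> v k"
  shows "pathin (order_complex_realization P) (edge_path n v)"
  unfolding pathin_def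
proof (rule pasting_lemma_closed)
  let ?T = "\<lambda>k. {t \<in> {0..1}. real k \<le> real n * t \<and> real n * t \<le> real (Suc k)}"
  show "finite {..<n}"
    by simp
  show "closedin (top_of_set {0..1}) (?T k)" for k
  proof -
    have "closed {t::real. real k \<le> real n * t}" "closed {t::real. real n * t \<le> real (Suc k)}"
      by (intro closed_Collect_le continuous_intros)+
    then have "closedin (top_of_set {0..1}) ({0..1} \<inter> ({t::real. real k \<le> real n * t} \<inter> {t. real n * t \<le> real (Suc k)}))"
      by (intro closedin_closed_Int closed_Int)
    also have "{0..1} \<inter> ({t::real. real k \<le> real n * t} \<inter> {t. real n * t \<le> real (Suc k)}) = ?T k"
      by auto
    finally show ?thesis .
  qed
  show "continuous_map (subtopology (top_of_set {0..1}) (?T k)) (order_complex_realization P) (edge_path n v)"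
    if "k \<in> {..<n}" for k
  proof -
    let ?\<sigma> = "{v k, v (Suc k)}"
    have "continuous_map (top_of_set (?T k)) euclideanreal (\<lambda>t::real. edge_path n v t x)" for x
      unfolding edge_path_def continuous_map_iff_continuous
      by (intro continuous_on_sum, rename_tac j, case_tac "v j = x") (auto intro!: continuous_intros)
    moreover have "edge_path n v t \<in> closed_simplex P ?\<sigma>" if "t \<in> ?T k" for t
    proof -
      have "edge_path n v t
          = (\<lambda>x. (if v k = x then real (Suc k) - real n * t else 0) + (if v (Suc k) = x then real n * t - real k else 0))"
        using that \<open>k \<in> {..<n}\<close> by (intro ext edge_path_on_edge) auto
      then show ?thesis
        using that \<open>k \<in> {..<n}\<close> vP [of k] vP [of "Suc k"] adj [of k]
        by (auto intro!: segment_in_closed_simplex)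
    qed
    ultimately have "continuous_map (top_of_set (?T k))
        (subtopology (powertop_real UNIV) (closed_simplex P ?\<sigma>)) (edge_path n v)"
      by (auto simp: continuous_map_in_subtopology continuous_map_componentwise_UNIV)
    moreover have "continuous_map (subtopology (powertop_real UNIV) (closed_simplex P ?\<sigma>))
        (order_complex_realization P) id"
      using that vP [of k] vP [of "Suc k"] adj [of k]
      by (intro continuous_map_closed_simplex_inclusion) (auto simp: subset_chain_def)
    ultimately have "continuous_map (top_of_set (?T k)) (order_complex_realization P) (id \<circ> edge_path n v)"
      by (rule continuous_map_compose)
    moreover have "subtopology (top_of_set {0..1}) (?T k) = top_of_set (?T k)"
      unfolding subtopology_subtopology by (rule arg_cong [where f = top_of_set]) auto
    ultimately show ?thesis
      by simp
  qed
  show "\<exists>k. k \<in> {..<n} \<and> t \<in> ?T k \<and> edge_path n v t = edge_path n v t"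
    if "t \<in> topspace (top_of_set {0..1})" for t
  proof -
    have t: "0 \<le> t" "t \<le> 1"
      using that by auto
    show ?thesis
    \<comment> \<open>At the right end the floor would be \<open>n\<close>, which indexes no edge,
      so the last edge is chosen.\<close>
    proof (cases "t = 1")
      case True
      then show ?thesis
        using n by (intro exI [of _ "n - 1"]) auto
    next
      case False
      let ?k = "nat \<lfloor>real n * t\<rfloor>"
      have "real n * t < n"
        using t False n by simp
      then have "?k < n" "real ?k \<le> real n * t" "real n * t \<le> real (Suc ?k)"
        using t n by (auto simp: nat_less_iff floor_less_iff) linarith+
      then show ?thesis
        using t by (intro exI [of _ ?k]) auto
    qed
  qed
qed auto

subsection \<open>Circle-valued maps around a maximal element\<close>

definition crossing :: "'c set \<Rightarrow> 'c set set \<Rightarrow> ('c set \<Rightarrow> real) \<Rightarrow> real" where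
  "crossing w A f = (if \<exists>y\<in>A. f y \<noteq> 0 then f w else 0)"

text \<open>Let \<open>A\<close> be a union of connected components of the link of a maximal element \<open>w\<close>. The map
  is constant outside the open star of \<open>w\<close> and on the part of the star in the direction of the other
  components; at the vertex \<open>w\<close> itself \<open>crossing\<close> jumps between the integers \<open>0\<close> and \<open>1\<close>.\<close>
lemma continuous_map_circ_crossing:
  assumes max: "\<And>z. \<lbrakk>z \<in> P; w \<subseteq> z\<rbrakk> \<Longrightarrow> z = w" and wA: "w \<notin> A"
    and comp: "\<And>y z. \<lbrakk>y \<in> A; z \<in> P; z \<subset> w; y \<subseteq> z \<or> z \<subseteq> y\<rbrakk> \<Longrightarrow> z \<in> A"
  shows "continuous_map (order_complex_realization P) (nsphere 1) (\<lambda>f. circ (- crossing w A f))"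
proof (rule continuous_map_from_order_complex_realization)
  fix \<sigma>
  assume \<sigma>: "finite \<sigma>" "\<sigma> \<subseteq> P" "subset_chain \<sigma>"
  let ?S = "subtopology (powertop_real UNIV) (closed_simplex P \<sigma>)"
  show "continuous_map ?S (nsphere 1) (\<lambda>f. circ (- crossing w A f))"
  proof (cases "w \<in> \<sigma> \<and> \<sigma> \<inter> A \<noteq> {}")
    case True
    then obtain y where y: "y \<in> \<sigma>" "y \<in> A" and w: "w \<in> \<sigma>"
      by blast
    \<comment> \<open>All vertices of \<sigma> other than \<open>w\<close> lie in \<open>A\<close>,
      so \<open>f w\<close> and \<open>crossing\<close> differ only at the vertex \<open>w\<close>,
      by the integer 1 that \<open>circ\<close> ignores.\<close>
    have eq: "circ (- f w) = circ (- crossing w A f)" if f: "f \<in> closed_simplex P \<sigma>" for f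
    proof (cases "\<exists>y\<in>A. f y \<noteq> 0")
      case False
      have "{x. f x \<noteq> 0} \<subseteq> {w}"
      proof
        fix z
        assume z: "z \<in> {x. f x \<noteq> 0}"
        then have z\<sigma>: "z \<in> \<sigma>" "z \<notin> A"
          using f False by (auto simp: closed_simplex_def)
        show "z \<in> {w}"
        proof (rule ccontr)
          assume "z \<notin> {w}"
          then have "z \<subset> w"
            using \<sigma> z\<sigma> w max unfolding subset_chain_def by (metis psubsetI singletonI subsetD)
          then show False
            using \<sigma> z\<sigma> y comp unfolding subset_chain_def by (metis subsetD)
        qed
      qed
      moreover have "sum f {x. f x \<noteq> 0} = 1"
        using f by (simp add: closed_simplex_def realization_points_def)
      ultimately have "f w = 1"
        by (cases "f w = 0") (auto simp: subset_singleton_iff)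
      moreover have "crossing w A f = 0"
        using False by (simp add: crossing_def)
      ultimately show ?thesis
        unfolding circ_eq_iff by (intro exI [of _ "-1"]) simp
    qed (simp add: crossing_def)
    have "continuous_map ?S euclideanreal (\<lambda>f. - f w)"
      by (intro continuous_map_minus continuous_map_from_subtopology continuous_map_product_projection) auto
    then have "continuous_map ?S (nsphere 1) (circ \<circ> (\<lambda>f. - f w))"
      by (rule continuous_map_compose [OF _ continuous_map_circ])
    then show ?thesis
      by (rule continuous_map_eq) (simp add: eq)
  next
    case False
    \<comment> \<open>Either \<open>w\<close> has no weight or no vertex in \<open>A\<close> has
      any.\<close>
    then have 0: "crossing w A f = 0" if "f \<in> closed_simplex P \<sigma>" for f
      using that unfolding closed_simplex_def crossing_def by auto
    have "continuous_map ?S (nsphere 1) (\<lambda>f. circ 0)"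
      by (simp only: continuous_map_const circ_in_nsphere simp_thms)
    then show ?thesis
      by (rule continuous_map_eq) (simp add: 0)
  qed
qed

lemma crossing_edge_path_0:
  assumes "\<And>k. k \<le> n \<Longrightarrow> v k \<noteq> w"
  shows "crossing w A (edge_path n v t) = 0"
proof -
  have "edge_path n v t w = 0"
    unfolding edge_path_def using assms by (intro sum.neutral) auto
  then show ?thesis
    by (simp add: crossing_def)
qed

lemma edge_path_vertex_1:
  assumes n: "2 \<le> n" and v: "\<And>k. k \<le> n \<Longrightarrow> v k = w \<longleftrightarrow> k = 1"
  shows "edge_path n v t w = max 0 (1 - \<bar>real n * t - 1\<bar>)"
proof -
  have "edge_path n v t w = (\<Sum>k\<in>{1}. max 0 (1 - \<bar>real n * t - real k\<bar>))"
    unfolding edge_path_def by (rule sum.mono_neutral_cong_right) (use n v in auto)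
  then show ?thesis
    by simp
qed

text \<open>While \<open>w\<close> carries weight, the path runs on the two edges at
  \<open>w\<close>, whose other ends avoid \<open>A\<close>; from time \<open>2 / n\<close> on the
  weight of \<open>w\<close> is zero.\<close>

lemma crossing_edge_path_avoid:
  assumes n: "2 \<le> n" and v: "\<And>k. k \<le> n \<Longrightarrow> v k = w \<longleftrightarrow> k = 1"
    and A: "v 0 \<notin> A" "w \<notin> A" "v 2 \<notin> A" and t: "t \<in> {0..1}"
  shows "crossing w A (edge_path n v t) = 0"
proof (cases "real n * t < 2")
  case True
  have v1: "v 1 = w"
    using v [of 1] n by simp
  have "edge_path n v t y = 0" if "y \<in> A" for y
  proof (cases "real n * t \<le> 1")
    case True
    then show ?thesis
      using edge_path_on_edge [of 0 n t v y] t n that A v1 by auto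
  next
    case False
    then show ?thesis
      using edge_path_on_edge [of 1 n t v y] \<open>real n * t < 2\<close> n that A v1 by (auto simp: numeral_2_eq_2)
  qed
  then show ?thesis
    by (auto simp: crossing_def)
next
  case False
  then show ?thesis
    using edge_path_vertex_1 [OF n v] by (auto simp: crossing_def)
qed

text \<open>Approaching \<open>w\<close> from outside \<open>A\<close> gives 0. Leaving towards
  \<open>A\<close>, the weight \<open>2 - real n * t\<close> of \<open>w\<close> makes the negated
  argument equal to \<open>real n * t - 1\<close> up to an integer. Afterwards the weight vanishes
  and \<open>circ 1 = circ 0\<close>. The minus sign makes the turn positive.\<close>

lemma circ_crossing_edge_path:
  assumes n: "2 \<le> n" and v: "\<And>k. k \<le> n \<Longrightarrow> v k = w \<longleftrightarrow> k = 1"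
    and A: "v 0 \<notin> A" "w \<notin> A" "v 2 \<in> A" and t: "t \<in> {0..1}"
  shows "circ (- crossing w A (edge_path n v t)) = circ (min 1 (max 0 (real n * t - 1)))"
proof -
  have v1: "v 1 = w"
    using v [of 1] n by simp
  have circ1: "circ 1 = circ 0"
    unfolding circ_eq_iff by (rule exI [of _ 1]) simp
  consider "real n * t \<le> 1" | "1 < real n * t" "real n * t < 2" | "2 \<le> real n * t"
    by linarith
  then show ?thesis
  proof cases
    case 1
    have "edge_path n v t y = 0" if "y \<in> A" for y
      using edge_path_on_edge [of 0 n t v y] t n 1 that A v1 by auto
    then show ?thesis
      using 1 by (auto simp: crossing_def)
  next
    case 2
    have "edge_path n v t (v 2) \<noteq> 0"
      using edge_path_on_edge [of 1 n t v "v 2"] 2 n A v1 by (auto simp: numeral_2_eq_2)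
    then have "crossing w A (edge_path n v t) = 2 - real n * t"
      using A(3) 2 edge_path_vertex_1 [OF n v] by (auto simp: crossing_def)
    moreover have "circ (real n * t - 2) = circ (real n * t - 1)"
      unfolding circ_eq_iff by (rule exI [of _ "-1"]) simp
    ultimately show ?thesis
      using 2 by simp
  next
    case 3
    then show ?thesis
      using edge_path_vertex_1 [OF n v] circ1 by (auto simp: crossing_def)
  qed
qed

text \<open>Interpolate linearly between \<open>u\<close> and the identity before applying
  \<open>circ\<close>; each stage runs from 0 to 1 and so closes up on the circle.\<close>

lemma homotopic_with_circ_reparam:
  assumes u: "continuous_on {0..1} u" "u 0 = 0" "u 1 = 1"
  shows "homotopic_with (\<lambda>q. q 0 = q 1) (top_of_set {0..1}) (nsphere 1) (circ \<circ> u) circ"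
proof -
  let ?h = "\<lambda>(s, t). (1 - s) * u t + s * t"
  have "continuous_on ({0..1} \<times> {0..1}) ?h"
    unfolding case_prod_unfold
    by (intro continuous_intros continuous_on_compose2 [OF u(1)]) auto
  then have "continuous_map (prod_topology (top_of_set {0..1}) (top_of_set {0..1})) euclideanreal ?h"
    by simp
  then have "continuous_map (prod_topology (top_of_set {0..1}) (top_of_set {0..1})) (nsphere 1) (circ \<circ> ?h)"
    by (rule continuous_map_compose [OF _ continuous_map_circ])
  moreover have "circ ((1 - s) * u 0 + s * 0) = circ ((1 - s) * u 1 + s * 1)" for s
    unfolding circ_eq_iff using u by (intro exI [of _ "-1"]) simp
  ultimately show ?thesis
    unfolding homotopic_with_def by (intro exI [of _ "circ \<circ> ?h"]) auto
qed

lemma homotopic_circ_crossing_edge_path: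
  assumes n: "2 \<le> n" and v: "\<And>k. k \<le> n \<Longrightarrow> v k = w \<longleftrightarrow> k = 1"
    and A: "v 0 \<notin> A" "w \<notin> A" "v 2 \<in> A"
  shows "homotopic_with (\<lambda>q. q 0 = q 1) (top_of_set {0..1}) (nsphere 1)
           ((\<lambda>f. circ (- crossing w A f)) \<circ> edge_path n v) circ"
proof -
  let ?u = "\<lambda>t. min 1 (max 0 (real n * t - 1))"
  have "homotopic_with (\<lambda>q. q 0 = q 1) (top_of_set {0..1}) (nsphere 1) (circ \<circ> ?u) circ"
    by (rule homotopic_with_circ_reparam) (use n in \<open>auto intro!: continuous_intros\<close>)
  then show ?thesis
    by (rule homotopic_with_eq) (auto simp: circ_crossing_edge_path [OF n v A])
qed

section \<open>Coset posets\<close>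

text \<open>The larger coset can be rewritten with representative \<open>g\<close>, which then
  cancels.\<close>

lemma (in group) l_coset_subset_imp_subset:
  assumes H: "subgroup H G" and K: "subgroup K G" and gh: "g \<in> carrier G" "h \<in> carrier G"
    and sub: "g <# H \<subseteq> h <# K"
  shows "H \<subseteq> K"
proof
  fix x
  assume x: "x \<in> H"
  have xc: "x \<in> carrier G"
    by (rule subgroup.mem_carrier [OF H x])
  have "g \<in> h <# K"
    using sub lcos_self [OF gh(1) H] by blast
  then have eq: "h <# K = g <# K"
    by (rule l_repr_independence [OF _ gh(2) K])
  have "g \<otimes> x \<in> g <# K"
    using x sub eq by (auto simp: l_coset_def)
  then obtain k where "k \<in> K" "g \<otimes> x = g \<otimes> k"
    by (auto simp: l_coset_def)
  then show "x \<in> K"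
    using gh(1) xc subgroup.mem_carrier [OF K] by auto
qed

text \<open>Otherwise \<open>k\<close> is coprime to the order of \<open>a\<close>, and Bezout
  coefficients write \<open>a\<close> as a power of \<open>a [^] k\<close>. This is what places
  proper subgroups of a cyclic p-group inside its unique maximal one.\<close>

lemma (in group) int_pow_in_subgroup_imp_dvd:
  assumes a: "a \<in> carrier G" "ord a = p ^ n" and p: "Factorial_Ring.prime p"
    and H: "subgroup H G" "a \<notin> H" "a [^] (k::int) \<in> H"
  shows "int p dvd k"
proof (rule ccontr)
  assume "\<not> int p dvd k"
  then have "coprime (int p) k"
    using p by (simp add: prime_imp_coprime)
  then have "coprime (int (p ^ n)) k"
    by simp
  then obtain u v where uv: "u * int (p ^ n) + v * k = 1"
    using bezout_int [of "int (p ^ n)" k] by (auto simp: coprime_iff_gcd_eq_1)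
  have "a = a [^] (int (p ^ n) * u + k * v)"
    using uv a by (simp add: mult.commute int_pow_1)
  also have "\<dots> = (a [^] int (p ^ n)) [^] u \<otimes> (a [^] k) [^] v"
    using a by (simp add: int_pow_mult int_pow_pow)
  also have "a [^] int (p ^ n) = \<one>"
    using a pow_ord_eq_1 int_pow_int by metis
  finally have "a = (a [^] k) [^] v"
    using a by simp
  then have "a \<in> H"
    using H subgroup_int_pow_closed by metis
  then show False
    using H by blast
qed

lemma (in group) singleton_l_coset: "x \<in> carrier G \<Longrightarrow> x <# {\<one>} = {x}"
  by (simp add: l_coset_def)

lemma (in group) self_in_generate: "x \<in> generate G {x}"
  by (simp add: generate.incl)

section \<open>A group with a maximal cyclic p-subgroup and a chosen generator\<close>

locale maximal_cyclic_p_subgroup = group G for G (structure) +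
  fixes M a p n
  assumes not_cyclic: "\<not> cyclic_group G"
    and maximal: "maximal_subgroup M G"
    and a: "a \<in> carrier G"
    and M_eq: "M = range (\<lambda>k::int. a [^] k)"
    and p: "Factorial_Ring.prime p" and n: "n \<ge> 1"
    and ord_a: "ord a = p ^ n"
begin

lemma M: "subgroup M G" "M \<noteq> carrier G" "M \<subseteq> carrier G"
  using maximal by (auto simp: maximal_subgroup_def dest: subgroup.subset)

lemma p_ge_2: "p \<ge> 2"
  using p prime_ge_2_nat by blast

lemma pow_in_M [simp]: "a [^] (k::int) \<in> M"
  by (simp add: M_eq)

lemma a_in_M: "a \<in> M"
  using pow_in_M [of 1] a by (simp add: int_pow_1)

text \<open>Exponents are determined modulo \<open>p ^ n\<close>, which \<open>p\<close> divides
  since \<open>n \<ge> 1\<close>; residues modulo \<open>p\<close> are thus well defined on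
  \<open>M\<close>.\<close>

lemma pow_eq_imp_mod_eq:
  assumes "a [^] (k::int) = a [^] (l::int)"
  shows "k mod int p = l mod int p"
proof -
  have "int (p ^ n) dvd k - l"
    using assms int_pow_eq [OF a] ord_a by (metis dvd_diff_commute)
  then have "int p dvd k - l"
    using n by (metis dvd_power dvd_trans of_nat_power zero_less_iff_neq_zero not_one_le_zero)
  then show ?thesis
    by (simp add: mod_eq_dvd_iff)
qed

lemma a_neq_one: "a \<noteq> \<one>"
  using pow_eq_imp_mod_eq [of 1 0] a p_ge_2 by (auto simp: int_pow_1)

lemma coset_posetI:
  assumes "g \<in> carrier G" "subgroup H G" "H \<noteq> carrier G"
  shows "g <# H \<in> coset_poset G"
  using assms by (auto simp: coset_poset_def)

lemma coset_posetE:
  assumes "z \<in> coset_poset G"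
  obtains h H where "h \<in> carrier G" "subgroup H G" "H \<noteq> carrier G" "z = h <# H" "h \<in> z"
  using assms lcos_self by (auto simp: coset_poset_def)

lemma singleton_in_coset_poset:
  assumes "x \<in> carrier G"
  shows "{x} \<in> coset_poset G"
proof -
  have "{\<one>} \<noteq> carrier G"
    using a a_neq_one by blast
  then show ?thesis
    using coset_posetI [OF assms triv_subgroup] assms by (simp add: singleton_l_coset)
qed

lemma subgroup_generate: "x \<in> carrier G \<Longrightarrow> subgroup (generate G {x}) G"
  by (simp add: generate_is_subgroup)

text \<open>Every cyclic subgroup is proper because \<open>G\<close> is not cyclic.\<close>

lemma cyclic_coset_in_coset_poset:
  assumes "g \<in> carrier G" "x \<in> carrier G"
  shows "g <# generate G {x} \<in> coset_poset G"
proof (rule coset_posetI)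
  show "generate G {x} \<noteq> carrier G"
    using not_cyclic assms(2) generate_pow [of x] by (auto simp: cyclic_group full_SetCompr_eq)
qed (use assms subgroup_generate in auto)

section \<open>The link of a coset of the maximal subgroup\<close>

definition rep :: "'a set \<Rightarrow> 'a" where
  "rep C = (SOME x. x \<in> carrier G \<and> C = x <# M)"

lemma
  assumes "C \<in> lcosets M"
  shows rep_carrier: "rep C \<in> carrier G" and rep_coset: "rep C <# M = C"
proof -
  have "\<exists>x. x \<in> carrier G \<and> C = x <# M"
    using assms by (auto simp: LCOSETS_def)
  then have "rep C \<in> carrier G \<and> C = rep C <# M"
    unfolding rep_def by (rule someI_ex)
  then show "rep C \<in> carrier G" "rep C <# M = C"
    by auto
qed

lemma coset_in_coset_poset: "C \<in> lcosets M \<Longrightarrow> C \<in> coset_poset G"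
  using coset_posetI M rep_carrier rep_coset by metis

text \<open>Inclusion of the cosets gives \<open>M \<subseteq> H\<close>, maximality gives
  \<open>H = M\<close>, and cosets of one subgroup that meet coincide.\<close>

lemma coset_maximal:
  assumes C: "C \<in> lcosets M" and z: "z \<in> coset_poset G" "C \<subseteq> z"
  shows "z = C"
proof -
  obtain h H where h: "h \<in> carrier G" "subgroup H G" "H \<noteq> carrier G" "z = h <# H"
    using z(1) by (rule coset_posetE)
  have "M \<subseteq> H"
    using l_coset_subset_imp_subset [OF M(1) h(2) rep_carrier [OF C] h(1)] z h rep_coset [OF C] by simp
  then have "H = M"
    using maximal h by (auto simp: maximal_subgroup_def)
  moreover have "rep C \<in> h <# H"
    using lcos_self [OF rep_carrier [OF C] M(1)] rep_coset [OF C] z h by auto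
  ultimately show ?thesis
    using l_repr_independence [of "rep C" h M] h M rep_coset [OF C] by simp
qed

text \<open>Residues on a coset make sense only relative to an origin, here \<open>rep C\<close>.
  For \<open>i < p\<close> this is a left coset of the subgroup generated by
  \<open>a [^] p\<close>.\<close>

definition sector :: "'a set \<Rightarrow> nat \<Rightarrow> 'a set" where
  "sector C i = {rep C \<otimes> a [^] (k::int) | k. k mod int p = int i}"

lemma sector_disjoint:
  assumes C: "C \<in> lcosets M" and x: "x \<in> sector C i" "x \<in> sector C j"
  shows "i = j"
proof -
  obtain k l :: int where "rep C \<otimes> a [^] k = rep C \<otimes> a [^] l" "k mod int p = i" "l mod int p = j"
    using x unfolding sector_def by auto
  then show ?thesis
    using pow_eq_imp_mod_eq [of k l] rep_carrier [OF C] a by simp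
qed

lemma rep_pow_in_sector: "i < p \<Longrightarrow> rep C \<otimes> a [^] int i \<in> sector C i"
  unfolding sector_def by force

lemma rep_in_sector: "C \<in> lcosets M \<Longrightarrow> rep C \<in> sector C 0"
  using rep_pow_in_sector [of 0 C] p_ge_2 rep_carrier by simp

text \<open>Write \<open>z = h <# H\<close>. Since \<open>H\<close> misses \<open>a\<close>, its
  elements have exponents divisible by \<open>p\<close>, and multiplying \<open>h\<close> by them
  keeps its residue.\<close>

lemma coset_below_in_sector:
  assumes C: "C \<in> lcosets M" and z: "z \<in> coset_poset G" "z \<subset> C"
  obtains i where "z \<subseteq> sector C i"
proof -
  obtain h H where h: "h \<in> carrier G" "subgroup H G" "z = h <# H" "h \<in> z"
    using z(1) by (rule coset_posetE)
  have HM: "H \<subseteq> M"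
    using l_coset_subset_imp_subset [OF h(2) M(1) h(1) rep_carrier [OF C]] z h rep_coset [OF C] by auto
  have hC: "h \<in> rep C <# M"
    using h z rep_coset [OF C] by auto
  \<comment> \<open>A subgroup \<open>H\<close> containing the generator would be \<open>M\<close>,
    and \<open>z\<close> would be all of \<open>C\<close>.\<close>
  have aH: "a \<notin> H"
  proof
    assume "a \<in> H"
    then have "M \<subseteq> H"
      using subgroup_int_pow_closed [OF h(2)] by (auto simp: M_eq)
    then have "z = h <# M"
      using HM h by auto
    then have "z = C"
      using l_repr_independence [OF hC rep_carrier [OF C] M(1)] rep_coset [OF C] by simp
    then show False
      using z by blast
  qed
  obtain l :: int where l: "h = rep C \<otimes> a [^] l"
    using hC by (auto simp: l_coset_def M_eq)
  have "z \<subseteq> sector C (nat (l mod int p))"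
  proof
    fix x
    assume "x \<in> z"
    then obtain k :: int where k: "a [^] k \<in> H" "x = h \<otimes> a [^] k"
      using h HM by (auto simp: l_coset_def M_eq)
    then have "int p dvd k"
      using int_pow_in_subgroup_imp_dvd [OF a ord_a p h(2) aH] by blast
    then have "(l + k) mod int p = int (nat (l mod int p))"
      using p_ge_2 by (simp add: mod_add_eq [symmetric] flip: dvd_eq_mod_eq_0) 
    moreover have "x = rep C \<otimes> a [^] (l + k)"
      using k l rep_carrier [OF C] a by (simp add: int_pow_mult m_assoc)
    ultimately show "x \<in> sector C (nat (l mod int p))"
      unfolding sector_def by blast
  qed
  then show thesis
    by (rule that)
qed

text \<open>For \<open>i < p\<close> the sector is itself a member, and the largest one, so this is
  a connected piece of the link of \<open>C\<close>.\<close>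

definition component :: "'a set \<Rightarrow> nat \<Rightarrow> 'a set set" where
  "component C i = {y \<in> coset_poset G. y \<subseteq> sector C i}"

text \<open>\<open>C\<close> meets the sectors 0 and 1, which are disjoint; both residues are
  available as \<open>p \<ge> 2\<close>.\<close>

lemma coset_notin_component:
  assumes C: "C \<in> lcosets M"
  shows "C \<notin> component C i"
proof
  assume "C \<in> component C i"
  then have sub: "rep C <# M \<subseteq> sector C i"
    using rep_coset [OF C] by (simp add: component_def)
  have "rep C \<in> sector C i" "rep C \<otimes> a [^] int 1 \<in> sector C i"
    using sub lcos_self [OF rep_carrier [OF C] M(1)] a_in_M a by (auto simp: l_coset_def)
  then show False
    using sector_disjoint [OF C] rep_in_sector [OF C] rep_pow_in_sector [of 1 C] p_ge_2
    by (metis Suc_1 Suc_le_lessD One_nat_def zero_neq_one)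
qed

text \<open>Cosets are nonempty, so comparable ones share a point; their sectors then meet and hence
  agree.\<close>

lemma component_closed:
  assumes C: "C \<in> lcosets M" and y: "y \<in> component C i"
    and z: "z \<in> coset_poset G" "z \<subset> C" and yz: "y \<subseteq> z \<or> z \<subseteq> y"
  shows "z \<in> component C i"
proof -
  obtain j where j: "z \<subseteq> sector C j"
    using coset_below_in_sector [OF C z] .
  have y': "y \<in> coset_poset G" "y \<subseteq> sector C i"
    using y by (auto simp: component_def)
  obtain x where "x \<in> y" "x \<in> z"
    using coset_posetE [OF z(1)] coset_posetE [OF y'(1)] yz by (metis subsetD)
  then have "i = j"
    using sector_disjoint [OF C] y' j by blast
  then show ?thesis
    using j z by (simp add: component_def)
qed

lemma singleton_in_component_iff:
  assumes "C \<in> lcosets M" "i < p"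
  shows "{rep C \<otimes> a [^] int i} \<in> component C j \<longleftrightarrow> i = j"
proof -
  have "rep C \<otimes> a [^] int i \<in> sector C j \<longleftrightarrow> i = j"
    using rep_pow_in_sector [OF assms(2)] sector_disjoint [OF assms(1)] by blast
  then show ?thesis
    using rep_carrier [OF assms(1)] a by (simp add: component_def singleton_in_coset_poset)
qed

section \<open>Hexagonal edge paths through a coset\<close>

definition out :: 'a where
  "out = (SOME b. b \<in> carrier G - M)"

lemma out: "out \<in> carrier G" "out \<notin> M"
proof -
  have "\<exists>b. b \<in> carrier G - M"
    using M by blast
  then have "out \<in> carrier G - M"
    unfolding out_def by (rule someI_ex)
  then show "out \<in> carrier G" "out \<notin> M"
    by auto
qed

lemma pow_out_notin_M: "a [^] (k::int) \<otimes> out \<notin> M"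
proof
  assume "a [^] k \<otimes> out \<in> M"
  then have "inv (a [^] k) \<otimes> (a [^] k \<otimes> out) \<in> M"
    using M(1) by (simp add: subgroup.m_closed subgroup.m_inv_closed)
  then show False
    using out a by (simp flip: m_assoc)
qed

text \<open>Since \<open>out\<close> and \<open>a [^] i \<otimes> out\<close> lie outside \<open>M\<close>, they generate proper subgroups different
  from \<open>M\<close>, so the last four edges avoid all left cosets of \<open>M\<close>.\<close>
definition hexagon :: "'a set \<Rightarrow> nat \<Rightarrow> nat \<Rightarrow> 'a set" where
  "hexagon C i k =
    (let r = rep C; s = r \<otimes> a [^] int i in
     [{r}, C, {s}, s <# generate G {out}, {s \<otimes> out}, r <# generate G {a [^] int i \<otimes> out}, {r}] ! k)"

lemma hexagon_cases:
  assumes "k \<le> (6::nat)"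
  obtains "k = 0" | "k = 1" | "k = 2" | "k = 3" | "k = 4" | "k = 5" | "k = 6"
  using assms by linarith

lemma hexagon_in_coset_poset:
  assumes C: "C \<in> lcosets M" and k: "k \<le> 6"
  shows "hexagon C i k \<in> coset_poset G"
  using k
  by (cases rule: hexagon_cases)
    (simp_all add: hexagon_def Let_def singleton_in_coset_poset cyclic_coset_in_coset_poset
      rep_carrier [OF C] a out coset_in_coset_poset [OF C])

lemma hexagon_adjacent:
  assumes C: "C \<in> lcosets M" and k: "k < 6"
  shows "hexagon C i k \<subseteq> hexagon C i (Suc k) \<or> hexagon C i (Suc k) \<subseteq> hexagon C i k"
proof -
  define r where "r = rep C"
  define s where "s = r \<otimes> a [^] int i"
  have rs: "r \<in> carrier G" "s \<in> carrier G" "a [^] int i \<otimes> out \<in> carrier G"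
    using rep_carrier [OF C] a out by (auto simp: r_def s_def)
  have 1: "r \<in> C"
    using lcos_self [OF rs(1) M(1)] rep_coset [OF C] by (simp add: r_def)
  have 2: "s \<in> C"
  proof -
    have "s \<in> rep C <# M"
      by (auto simp: s_def r_def l_coset_def)
    then show ?thesis
      by (simp only: rep_coset [OF C])
  qed
  have 3: "s \<in> s <# generate G {out}" "r \<in> r <# generate G {a [^] int i \<otimes> out}"
    using rs out by (auto intro!: lcos_self subgroup_generate)
  have 4: "s \<otimes> out \<in> s <# generate G {out}"
    using self_in_generate by (auto simp: l_coset_def)
  \<comment> \<open>\<open>s \<otimes> out\<close> is also \<open>r\<close> times the generator of
    the second cyclic subgroup, which closes the hexagon.\<close>
  have 5: "s \<otimes> out \<in> r <# generate G {a [^] int i \<otimes> out}"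
  proof -
    have "s \<otimes> out = r \<otimes> (a [^] int i \<otimes> out)"
      using rs a out by (simp add: s_def m_assoc)
    then show ?thesis
      using self_in_generate by (auto simp: l_coset_def)
  qed
  show ?thesis
    using less_imp_le [OF k]
    by (cases rule: hexagon_cases)
      (use k 1 2 3 4 5 in \<open>simp_all add: hexagon_def Let_def r_def [symmetric] s_def [symmetric]\<close>)
qed

text \<open>Singletons are too small since \<open>a\<close> is nontrivial, and a cyclic coset equal
  to a coset of \<open>M\<close> would put its generator into \<open>M\<close>.\<close>

lemma hexagon_eq_coset_iff:
  assumes C: "C \<in> lcosets M" and D: "D \<in> lcosets M" and k: "k \<le> 6"
  shows "hexagon C i k = D \<longleftrightarrow> k = 1 \<and> C = D"
proof -
  have single: "{x} \<noteq> D" if "x \<in> carrier G" for x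
  proof
    assume "{x} = D"
    then have "M \<subseteq> {\<one>}"
      using l_coset_subset_imp_subset [OF M(1) triv_subgroup rep_carrier [OF D] that]
        rep_coset [OF D] singleton_l_coset [OF that] by simp
    then show False
      using a_in_M a_neq_one by blast
  qed
  have gen: "g <# generate G {x} \<noteq> D" if "g \<in> carrier G" "x \<in> carrier G" "x \<notin> M" for g x
  proof
    assume "g <# generate G {x} = D"
    then have "generate G {x} \<subseteq> M"
      using l_coset_subset_imp_subset [OF subgroup_generate M(1) that(1) rep_carrier [OF D]]
        that rep_coset [OF D] by simp
    then show False
      using self_in_generate that by blast
  qed
  show ?thesis
    using k
    by (cases rule: hexagon_cases)
      (simp_all add: hexagon_def Let_def single gen rep_carrier [OF C] a out pow_out_notin_M)
qed

section \<open>Degrees of the circle maps along the hexagons\<close>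

abbreviation realization :: "('a set \<Rightarrow> real) topology" where
  "realization \<equiv> order_complex_realization (coset_poset G)"

abbreviation circle_map :: "'a set \<times> nat \<Rightarrow> ('a set \<Rightarrow> real) \<Rightarrow> nat \<Rightarrow> real" where
  "circle_map \<equiv> \<lambda>(C, i) f. circ (- crossing C (component C i) f)"

abbreviation loop :: "'a set \<times> nat \<Rightarrow> real \<Rightarrow> 'a set \<Rightarrow> real" where
  "loop \<equiv> \<lambda>(C, i). edge_path 6 (hexagon C i)"

lemma continuous_map_circle_map:
  assumes "C \<in> lcosets M"
  shows "continuous_map realization (nsphere 1) (circle_map (C, i))"
  unfolding case_prod_conv
proof (rule continuous_map_circ_crossing)
  show "\<And>z. \<lbrakk>z \<in> coset_poset G; C \<subseteq> z\<rbrakk> \<Longrightarrow> z = C"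
    using assms by (rule coset_maximal)
  show "C \<notin> component C i"
    using assms by (rule coset_notin_component)
  show "\<And>y z. \<lbrakk>y \<in> component C i; z \<in> coset_poset G; z \<subset> C; y \<subseteq> z \<or> z \<subseteq> y\<rbrakk> \<Longrightarrow> z \<in> component C i"
    using assms by (rule component_closed)
qed

lemma pathin_loop:
  assumes "C \<in> lcosets M"
  shows "pathin realization (loop (C, i))"
  unfolding case_prod_conv
  using hexagon_in_coset_poset [OF assms] hexagon_adjacent [OF assms] by (intro pathin_edge_path) simp_all

lemma loop_closed: "loop (C, i) 0 = loop (C, i) 1"
  by (simp add: edge_path_0 edge_path_1 hexagon_def Let_def)

lemma hexagon_0_in_component_iff:
  assumes "C \<in> lcosets M"
  shows "hexagon C i 0 \<in> component C j \<longleftrightarrow> j = 0"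
  using singleton_in_component_iff [OF assms, of 0 j] rep_carrier [OF assms] p_ge_2
  by (auto simp: hexagon_def Let_def)

lemma hexagon_2_in_component_iff:
  assumes "C \<in> lcosets M" "i < p"
  shows "hexagon C i 2 \<in> component C j \<longleftrightarrow> i = j"
  using singleton_in_component_iff [OF assms, of j] by (simp add: hexagon_def Let_def)

text \<open>The hexagon enters \<open>C\<close> from component 0 and leaves into component
  \<open>i\<close>, and these differ as \<open>i\<close> is nonzero.\<close>

lemma circle_map_loop_homotopic:
  assumes C: "C \<in> lcosets M" and i: "i \<in> {1..<p}"
  shows "homotopic_with (\<lambda>q. q 0 = q 1) (top_of_set {0..1}) (nsphere 1)
           (circle_map (C, i) \<circ> loop (C, i)) circ"
  unfolding case_prod_conv
  by (rule homotopic_circ_crossing_edge_path)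
    (use i in \<open>simp_all add: hexagon_eq_coset_iff [OF C C] hexagon_0_in_component_iff [OF C]
       hexagon_2_in_component_iff [OF C] coset_notin_component [OF C]\<close>)

text \<open>Over the same coset the loop joins components 0 and \<open>j\<close>, both different
  from \<open>i\<close>; over another coset it never visits \<open>C\<close>.\<close>

lemma circle_map_other_loop:
  assumes C: "C \<in> lcosets M" and i: "i \<in> {1..<p}" and D: "D \<in> lcosets M" and j: "j \<in> {1..<p}"
    and ne: "(C, i) \<noteq> (D, j)" and t: "t \<in> {0..1}"
  shows "circle_map (C, i) (loop (D, j) t) = circ 0"
proof (cases "C = D")
  case True
  then have "crossing C (component C i) (edge_path 6 (hexagon D j) t) = 0"
    using ne i j t
    by (intro crossing_edge_path_avoid)
      (simp_all add: hexagon_eq_coset_iff [OF D D] hexagon_0_in_component_iff [OF D]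
       hexagon_2_in_component_iff [OF D] coset_notin_component [OF D])
  then show ?thesis
    by simp
next
  case False
  then have "crossing C (component C i) (edge_path 6 (hexagon D j) t) = 0"
    by (intro crossing_edge_path_0) (simp add: hexagon_eq_coset_iff [OF D C])
  then show ?thesis
    by simp
qed

text \<open>Working with finite subfamilies of the index set serves finite and infinite groups
  alike.\<close>

lemma rank_at_least_H1:
  assumes J: "finite J" "J \<subseteq> (lcosets M) \<times> {1..<p}"
  shows "rank_at_least (homology_group 1 realization) (card J)"
proof (rule rank_at_least_homology_circle_maps [where \<gamma> = loop and \<phi> = circle_map and a = "circ 0", OF J(1)])
  fix x
  assume "x \<in> J"
  then obtain C i where x: "x = (C, i)" "C \<in> lcosets M" "i \<in> {1..<p}"
    using J by blast
  show "pathin realization (loop x)"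
    using pathin_loop x by blast
  show "loop x 0 = loop x 1"
    using loop_closed x by blast
  show "continuous_map realization (nsphere 1) (circle_map x)"
    using continuous_map_circle_map x by blast
  show "homotopic_with (\<lambda>q. q 0 = q 1) (top_of_set {0..1}) (nsphere 1) (circle_map x \<circ> loop x) circ"
    using circle_map_loop_homotopic x by blast
next
  fix x y and t :: real
  assume "x \<in> J" "y \<in> J" "x \<noteq> y" "t \<in> {0..1}"
  moreover obtain C i D j where "x = (C, i)" "y = (D, j)"
    by (metis surj_pair)
  ultimately show "circle_map x (loop y t) = circ 0"
    using J circle_map_other_loop by blast
qed

lemma M_in_lcosets: "M \<in> lcosets M"
  using M lcos_mult_one [of M] by (force simp: LCOSETS_def)

text \<open>One loop suffices: the coset \<open>M\<close> with residue 1, a legitimate index because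
  \<open>p \<ge> 2\<close>.\<close>

lemma not_simply_connected: "\<not> simply_connected_space realization"
proof (rule not_simply_connected_circle_map)
  show "homotopic_with (\<lambda>q. q 0 = q 1) (top_of_set {0..1}) (nsphere 1) (circle_map (M, 1) \<circ> loop (M, 1)) circ"
    by (rule circle_map_loop_homotopic [OF M_in_lcosets]) (use p_ge_2 in simp)
qed (fact pathin_loop [OF M_in_lcosets] loop_closed continuous_map_circle_map [OF M_in_lcosets])+

section \<open>Counting cosets and residues\<close>

lemma finite_M: "finite M" "card M > 0"
proof -
  have "M = generate G {a}"
    using generate_pow [OF a] by (auto simp: M_eq)
  then have "card M = p ^ n"
    using generate_pow_card [OF a] ord_a by simp
  then show "card M > 0"
    using p_ge_2 by simp
  then show "finite M"
    using card_gt_0_iff by blast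
qed

text \<open>The loops are indexed by left cosets while the bound counts right cosets; Lagrange's
  theorem on both sides identifies the two numbers.\<close>

lemma card_index_set:
  assumes "finite (carrier G)"
  shows "finite ((lcosets M) \<times> {1..<p})" "card ((lcosets M) \<times> {1..<p}) = (p - 1) * card (rcosets M)"
proof -
  have "finite (lcosets M)"
    using assms lcosets_subset_PowG [OF M(1)] by (meson finite_Pow_iff finite_subset)
  then show "finite ((lcosets M) \<times> {1..<p})"
    by simp
  have "card (lcosets M) * card M = card (rcosets M) * card M"
    using l_lagrange [OF assms M(1)] lagrange [OF M(1)] by simp
  then show "card ((lcosets M) \<times> {1..<p}) = (p - 1) * card (rcosets M)"
    using a_in_M finite_M by (auto simp: card_cartesian_product)
qed

text \<open>The cosets of \<open>M\<close> are finite and cover \<open>G\<close>, so finitely many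
  of them would make \<open>G\<close> finite.\<close>

lemma infinite_index_set:
  assumes "infinite (carrier G)"
  shows "infinite ((lcosets M) \<times> {1..<p})"
proof
  assume "finite ((lcosets M) \<times> {1..<p})"
  then have "finite (lcosets M)"
    using p_ge_2 by (auto simp: finite_cartesian_product_iff)
  moreover have "finite C" if "C \<in> lcosets M" for C
    using that finite_M by (auto simp: LCOSETS_def l_coset_def)
  ultimately have "finite (\<Union> (lcosets M))"
    by blast
  then show False
    using assms lcosets_part_G [OF M(1)] by simp
qed

end

theorem mainTheorem10:
  fixes G :: "('a, 'b) monoid_scheme" and M :: "'a set" and p n :: nat
  assumes "group G"
    and "\<not> cyclic_group G"
    and "maximal_subgroup M G"
    and "cyclic_group (G\<lparr>carrier := M\<rparr>)"
    and "Factorial_Ring.prime p" and "n \<ge> 1" and "card M = p ^ n"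
  shows "(finite (carrier G) \<longrightarrow>
            rank_at_least (homology_group 1 (order_complex_realization (coset_poset G)))
              ((p - 1) * card (rcosets\<^bsub>G\<^esub> M)))
       \<and> (infinite (carrier G) \<longrightarrow>
            infinite_rank (homology_group 1 (order_complex_realization (coset_poset G))))
       \<and> \<not> simply_connected_space (order_complex_realization (coset_poset G))"
proof -
  interpret group G by fact
  have M: "subgroup M G"
    using assms(3) by (simp add: maximal_subgroup_def)
  obtain a where a: "a \<in> M" "M = range (\<lambda>k::int. a [^]\<^bsub>G\<lparr>carrier := M\<rparr>\<^esub> k)"
    using assms(4) group.cyclic_group [OF subgroup_imp_group [OF M]] by auto
  have aG: "a \<in> carrier G"
    by (rule subgroup.mem_carrier [OF M a(1)])
  \<comment> \<open>The generator comes from \<open>M\<close> as a group in its own right; its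
    powers there agree with those in \<open>G\<close>.\<close>
  have "(\<lambda>k::int. a [^]\<^bsub>G\<lparr>carrier := M\<rparr>\<^esub> k) = (\<lambda>k. a [^]\<^bsub>G\<^esub> k)"
    by (rule ext) (rule int_pow_consistent [OF M a(1), symmetric])
  then have M_eq: "M = range (\<lambda>k::int. a [^]\<^bsub>G\<^esub> k)"
    using a(2) by (simp only:)
  \<comment> \<open>The order of \<open>a\<close> is the cardinality of the subgroup it generates,
    which is \<open>M\<close>.\<close>
  moreover have "generate G {a} = range (\<lambda>k::int. a [^]\<^bsub>G\<^esub> k)"
    using generate_pow [OF aG] by auto
  ultimately have "ord a = p ^ n"
    using generate_pow_card [OF aG] assms(7) by metis
  then interpret maximal_cyclic_p_subgroup G M a p n
    using assms aG M_eq by unfold_locales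
  show ?thesis
  proof (intro conjI impI)
    assume "finite (carrier G)"
    then show "rank_at_least (homology_group 1 realization) ((p - 1) * card (rcosets\<^bsub>G\<^esub> M))"
      using rank_at_least_H1 [OF card_index_set(1)] card_index_set(2) by simp
  next
    assume "infinite (carrier G)"
    \<comment> \<open>An infinite index set has finite subsets of every size.\<close>
    then show "infinite_rank (homology_group 1 realization)"
      unfolding infinite_rank_def
      using rank_at_least_H1 infinite_arbitrarily_large [OF infinite_index_set] by metis
  qed (rule not_simply_connected)
qed

end
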